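(* Let $X_0$ be a random variable with values in $\left]0,+\infty\right[$ defined on a probability space $(\Omega,\mathcal F,\mathbf P_0)$. Let $\mathbf\Lambda$ denote the Lebesgue measure on $[0,1]$. Let $X$ be the random variable on $\Omega\times[0,1]$, equipped with the probability measure $\mathbf P := \mathbf P_0 \otimes \mathbf\Lambda$, defined by $$X(\omega,u) = 10^u \, X_0(\omega).$$ Let $D(\omega,u)\in\{1,\dots,9\}$ denote the first digit in base $10$ of $X(\omega,u)$. Then for every $k \in \{1,\dots,9\}$, $$\mathbf P(D = k) = \log\Bigl(\frac{k+1}{k}\Bigr).$$
   Context: $\log$ denotes the logarithm in base $10$. For a real number $x>0$, the first digit of $x$ in base $10$ is the unique $k\in\{1,\dots,9\}$ such that $x \in \left[k\,10^n,(k+1)\,10^n\right[$ for some $n\in\mathbb Z$. No assumption is made on the law of $X_0$ (in particular it need not have a density). The interval $[0,1]$ carries its Borel $\sigma$-algebra and $\Omega\times[0,1]$ the product $\sigma$-algebra. *)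

theory Defs
  imports "HOL-Probability.Probability"
begin

definition is_first_digit :: "real \<Rightarrow> nat \<Rightarrow> bool" where
  "is_first_digit x k \<longleftrightarrow>
     k \<in> {1..9} \<and> (\<exists>n::int. x \<in> {real k * 10 powi n ..< real (k + 1) * 10 powi n})"

text \<open>The description is meaningful only for positive arguments; see
  \<open>first_digit_ex1\<close> below.\<close>

definition first_digit :: "real \<Rightarrow> nat" where
  "first_digit x = (THE k. is_first_digit x k)"

lemma first_digit_ex1:
  fixes x :: real
  assumes "x > 0"
  shows "\<exists>!k. is_first_digit x k"
proof (rule ex_ex1I)
  define n where "n = \<lfloor>log 10 x\<rfloor>"
  have pos: "(10::real) powi n > 0" by simp
  have pw: "(10::real) powi m = 10 powr m" for m :: int
    by (simp add: powr_real_of_int')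
  have x: "x = 10 powr (log 10 x)" using assms by simp
  have lo: "10 powi n \<le> x"
    unfolding pw by (subst x, subst powr_le_cancel_iff) (auto simp: n_def)
  have "x < 10 powr (of_int n + 1)"
    by (subst x, subst powr_less_cancel_iff) (auto simp: n_def)
  then have hi: "x < 10 * 10 powi n"
    unfolding pw by (simp add: powr_add)
  define j where "j = \<lfloor>x / 10 powi n\<rfloor>"
  have "1 \<le> x / 10 powi n" "x / 10 powi n < 10"
    using lo hi pos by (simp_all add: field_simps)
  then have j: "1 \<le> j" "j < 10"
    unfolding j_def by (auto simp: le_floor_iff floor_less_iff)
  have "of_int j \<le> x / 10 powi n" "x / 10 powi n < of_int j + 1"
    unfolding j_def by linarith+
  then have b: "of_int j * 10 powi n \<le> x" "x < (of_int j + 1) * 10 powi n"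
    using pos by (simp_all add: field_simps)
  have "real (nat j) = of_int j" using j by simp
  then have "x \<in> {real (nat j) * 10 powi n ..< real (nat j + 1) * 10 powi n}"
    using b by (simp add: add.commute)
  moreover have "nat j \<in> {1..9}" using j by auto
  ultimately show "\<exists>k. is_first_digit x k"
    unfolding is_first_digit_def by blast
next
  have less: "n \<le> m" if "is_first_digit x k" "is_first_digit x l"
    "real k * 10 powi n \<le> x" "x < real (l + 1) * 10 powi m" for k l :: nat and m n :: int
  proof (rule ccontr)
    assume "\<not> n \<le> m"
    then have "m + 1 \<le> n" by simp
    then have "(10::real) powi (m + 1) \<le> 10 powi n"
      by (intro power_int_increasing) auto
    then have "10 * 10 powi m \<le> (10::real) powi n"
      by (simp add: power_int_add)
    also have "\<dots> \<le> real k * 10 powi n"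
      using that(1) by (simp add: is_first_digit_def)
    also have "\<dots> < real (l + 1) * 10 powi m" using that by simp
    also have "\<dots> \<le> 10 * 10 powi m"
      using that(2) by (intro mult_right_mono) (auto simp: is_first_digit_def)
    finally show False by simp
  qed
  fix k l
  assume k: "is_first_digit x k" and l: "is_first_digit x l"
  obtain n where n: "real k * 10 powi n \<le> x" "x < real (k + 1) * 10 powi n"
    using k unfolding is_first_digit_def by auto
  obtain m where m: "real l * 10 powi m \<le> x" "x < real (l + 1) * 10 powi m"
    using l unfolding is_first_digit_def by auto
  have nm: "n = m"
    using less[OF k l n(1) m(2)] less[OF l k m(1) n(2)] by simp
  have pos: "(10::real) powi m > 0" by simp
  have "real k * 10 powi m < real (l + 1) * 10 powi m" "real l * 10 powi m < real (k + 1) * 10 powi m"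
    using le_less_trans[OF n(1)[unfolded nm] m(2)] le_less_trans[OF m(1) n(2)[unfolded nm]] by blast+
  then have "real k < real (l + 1)" "real l < real (k + 1)"
    using pos mult_less_cancel_right_pos by blast+
  then show "k = l" by linarith
qed

definition lebesgue_01 :: "real measure" where
  "lebesgue_01 = restrict_space lborel {0..1}"

definition scaled_rv :: "('a \<Rightarrow> real) \<Rightarrow> 'a \<times> real \<Rightarrow> real" where
  "scaled_rv X0 = (\<lambda>(\<omega>, u). 10 powr u * X0 \<omega>)"

end

theory Submission
  imports Defs
begin

text \<open>For fixed \<open>x > 0\<close>, the number \<open>10 powr u * x\<close> has first digit \<open>k\<close> iff \<open>u\<close> lies, modulo 1,
  in the window of length \<open>log 10 ((k + 1) / k)\<close> starting at \<open>log 10 k - log 10 x\<close>. As \<open>u\<close> is uniform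
  on a full period, this has probability \<open>log 10 ((k + 1) / k)\<close> whatever \<open>x\<close> is, and Fubini's
  theorem removes the conditioning on \<open>X0\<close>.\<close>

lemma first_digit_eq_iff:
  assumes "x > 0"
  shows "first_digit x = k \<longleftrightarrow> is_first_digit x k"
  unfolding first_digit_def
  using theI'[OF first_digit_ex1[OF assms]] the1_equality[OF first_digit_ex1[OF assms]] by blast

text \<open>\<open>log 10\<close> is increasing and turns the factor \<open>10 powi n\<close> into
  the shift by \<open>n\<close>, so the same integer \<open>n\<close> witnesses both sides.\<close>

lemma is_first_digit_iff_log:
  assumes "x > 0" "k \<in> {1..9}"
  shows "is_first_digit x k \<longleftrightarrow>
    (\<exists>n::int. log 10 (real k) + of_int n \<le> log 10 x \<and> log 10 x < log 10 (real (k + 1)) + of_int n)"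
proof -
  have log_shift: "log 10 (real j * 10 powi n) = log 10 (real j) + of_int n" if "j > 0" for j :: nat and n :: int
    using that by (simp add: log_mult powr_real_of_int' [symmetric])
  have "real k * 10 powi n \<le> x \<longleftrightarrow> log 10 (real k) + of_int n \<le> log 10 x" for n :: int
    using assms by (subst log_shift[symmetric], simp, subst log_le_cancel_iff) auto
  moreover have "x < real (k + 1) * 10 powi n \<longleftrightarrow> log 10 x < log 10 (real (k + 1)) + of_int n" for n :: int
    using assms by (subst log_shift[symmetric], simp, subst log_less_cancel_iff) auto
  ultimately show ?thesis
    using assms(2) by (simp only: is_first_digit_def atLeastLessThan_iff simp_thms)
qed

text \<open>Modulo 1 the window is an arc of length \<open>L\<close> on a circle of circumference 1,
  so its measure cannot depend on \<open>c\<close>. Cutting the circle at 0 splits the arc into at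
  most two intervals.\<close>

lemma emeasure_periodic_window:
  fixes c L :: real
  assumes "0 \<le> L" "L \<le> 1"
  shows "emeasure lborel {u\<in>{0..1}. \<exists>n::int. c + of_int n \<le> u \<and> u < c + of_int n + L} = ennreal L"
    (is "emeasure lborel ?S = _")
proof -
  define d where "d = frac c"
  have d: "0 \<le> d" "d < 1" and c: "c = d + of_int \<lfloor>c\<rfloor>"
    by (auto simp: d_def frac_lt_1) (simp add: frac_def)
  have [measurable]: "?S \<in> sets lborel" by measurable
  \<comment> \<open>The null point 1 is dropped because for \<open>d = 0\<close> and
    \<open>L > 0\<close> it would bring in a third translate. Of the remaining pieces, the first
    comes from the window at \<open>d\<close>, the second from the window at \<open>d - 1\<close>,
    which holds what wraps around.\<close>
  have S: "?S - {1} = {d..<min 1 (d + L)} \<union> {0..<d - 1 + L}" (is "_ = ?T")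
  proof (intro equalityI subsetI)
    fix u assume u: "u \<in> ?S - {1}"
    then obtain n :: int where n: "c + of_int n \<le> u" "u < c + of_int n + L" and u01: "0 \<le> u" "u < 1"
      by force
    define m where "m = n + \<lfloor>c\<rfloor>"
    have m: "d + of_int m \<le> u" "u < d + of_int m + L"
      using n c by (auto simp: m_def)
    \<comment> \<open>The bounds come from \<open>d + m \<le> u < 1\<close> and
      \<open>0 \<le> u < d + m + L < m + 2\<close>.\<close>
    have "of_int m < (1::real)" "of_int m > (-2::real)" using m u01 d assms by linarith+
    then have "m = 0 \<or> m = -1" by linarith
    then show "u \<in> ?T" using m u01 by auto
  next
    fix u assume "u \<in> ?T"
    then consider "u \<in> {d..<min 1 (d + L)}" | "u \<in> {0..<d - 1 + L}" by blast
    then show "u \<in> ?S - {1}"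
    proof cases
      case 1
      have "c + of_int (- \<lfloor>c\<rfloor>) = d" using c by simp
      with 1 d show ?thesis by (auto intro!: exI[of _ "- \<lfloor>c\<rfloor>"])
    next
      case 2
      have "c + of_int (- \<lfloor>c\<rfloor> - 1) = d - 1" using c by simp
      with 2 d assms show ?thesis by (auto intro!: exI[of _ "- \<lfloor>c\<rfloor> - 1"])
    qed
  qed
  have "emeasure lborel ?S = emeasure lborel (?S - {1})"
    by (subst emeasure_Diff_null_set) (auto simp: null_sets_def)
  \<comment> \<open>The pieces are disjoint since \<open>L \<le> 1\<close> gives
    \<open>d - 1 + L \<le> d\<close>.\<close>
  also have "\<dots> = emeasure lborel {d..<min 1 (d + L)} + emeasure lborel {0..<d - 1 + L}"
    unfolding S using assms by (intro plus_emeasure[symmetric]) auto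
  also have "\<dots> = ennreal (min 1 (d + L) - d) + ennreal (max 0 (d - 1 + L))"
    using d assms by (auto simp: max_def)
  also have "\<dots> = ennreal (min 1 (d + L) - d + max 0 (d - 1 + L))"
    using d assms by (intro ennreal_plus[symmetric]) auto
  also have "min 1 (d + L) - d + max 0 (d - 1 + L) = L"
    by linarith
  finally show ?thesis .
qed

lemma space_lebesgue_01: "space lebesgue_01 = {0..1}"
  by (simp add: lebesgue_01_def space_restrict_space)

lemma prob_space_lebesgue_01: "prob_space lebesgue_01"
  unfolding lebesgue_01_def by (rule prob_space_restrict_space) auto

lemma emeasure_lebesgue_01:
  assumes "A \<subseteq> {0..1}"
  shows "emeasure lebesgue_01 A = emeasure lborel A"
  using assms unfolding lebesgue_01_def by (intro emeasure_restrict_space) auto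

lemma borel_measurable_scaled_rv:
  assumes [measurable]: "X0 \<in> borel_measurable M"
  shows "scaled_rv X0 \<in> borel_measurable (M \<Otimes>\<^sub>M lebesgue_01)"
proof -
  have [measurable]: "(\<lambda>u. u) \<in> borel_measurable lebesgue_01"
    unfolding lebesgue_01_def by (intro measurable_restrict_space1) simp
  have [measurable]: "(\<lambda>z. snd z) \<in> borel_measurable (M \<Otimes>\<^sub>M lebesgue_01)"
    by (rule measurable_compose[OF measurable_snd]) measurable
  show ?thesis unfolding scaled_rv_def case_prod_beta by measurable
qed

text \<open>After taking logarithms, \<open>x\<close> enters only through the offset
  \<open>c\<close> of the window, on which the measure does not depend.\<close>

lemma emeasure_first_digit_scaled:
  assumes x: "x > 0" and k: "k \<in> {1..9}"
  shows "emeasure lebesgue_01 {u\<in>{0..1}. first_digit (10 powr u * x) = k}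
    = ennreal (log 10 (real (k + 1) / real k))"
proof -
  define L where "L = log 10 (real (k + 1) / real k)"
  define c where "c = log 10 (real k) - log 10 x"
  have L: "log 10 (real (k + 1)) = log 10 (real k) + L"
    using k by (simp add: L_def log_divide)
  \<comment> \<open>Since \<open>k \<ge> 1\<close>, a window is no longer than one period, as the
    measure formula requires.\<close>
  have "real (k + 1) / real k \<le> 10" "1 \<le> real (k + 1) / real k"
    using k by (auto simp: field_simps)
  then have L01: "0 \<le> L" "L \<le> 1"
    using k by (auto simp: L_def)
  have "first_digit (10 powr u * x) = k \<longleftrightarrow> (\<exists>n::int. c + of_int n \<le> u \<and> u < c + of_int n + L)" for u
  proof -
    have pos: "10 powr u * x > 0" and log: "log 10 (10 powr u * x) = u + log 10 x"
      using x by (simp_all add: log_mult)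
    show ?thesis
      unfolding first_digit_eq_iff[OF pos] is_first_digit_iff_log[OF pos k] log L c_def
      by (intro ex_cong1) linarith
  qed
  then show ?thesis
    using emeasure_periodic_window[OF L01, of c] by (subst emeasure_lebesgue_01) (auto simp: L_def)
qed

theorem theorem2:
  fixes P0 :: "'a measure" and X0 :: "'a \<Rightarrow> real"
  assumes "prob_space P0"
    and "X0 \<in> borel_measurable P0"
    and "\<And>\<omega>. \<omega> \<in> space P0 \<Longrightarrow> X0 \<omega> > 0"
  shows "\<forall>k\<in>{1..9::nat}.
    measure (P0 \<Otimes>\<^sub>M lebesgue_01)
      {z \<in> space (P0 \<Otimes>\<^sub>M lebesgue_01). first_digit (scaled_rv X0 z) = k}
    = log 10 (real (k + 1) / real k)"
proof
  fix k :: nat assume k: "k \<in> {1..9}"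
  interpret P0: prob_space P0 by fact
  interpret U: prob_space lebesgue_01 by (rule prob_space_lebesgue_01)
  note [measurable] = borel_measurable_scaled_rv[OF assms(2)]
  let ?M = "P0 \<Otimes>\<^sub>M lebesgue_01"
  let ?A = "{z \<in> space ?M. first_digit (scaled_rv X0 z) = k}"
  have pos: "scaled_rv X0 z > 0" if "z \<in> space ?M" for z
    using that assms(3) by (auto simp: scaled_rv_def space_pair_measure)
  \<comment> \<open>Replacing the definite description by the predicate makes the event a countable
    union, over the exponent \<open>n\<close>, of preimages of intervals.\<close>
  have "?A = {z \<in> space ?M. is_first_digit (scaled_rv X0 z) k}"
    using first_digit_eq_iff[OF pos] by blast
  also have "\<dots> \<in> sets ?M"
    unfolding is_first_digit_def by measurable
  finally have A: "?A \<in> sets ?M" .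
  have slice: "emeasure lebesgue_01 (Pair \<omega> -` ?A) = ennreal (log 10 (real (k + 1) / real k))"
    if "\<omega> \<in> space P0" for \<omega>
  proof -
    have "Pair \<omega> -` ?A = {u\<in>{0..1}. first_digit (10 powr u * X0 \<omega>) = k}"
      using that by (auto simp: space_pair_measure space_lebesgue_01 scaled_rv_def)
    then show ?thesis
      using emeasure_first_digit_scaled[OF assms(3)[OF that] k] by simp
  qed
  \<comment> \<open>All slices have the same measure, so the integrand is constant and the law of
    \<open>X0\<close> drops out.\<close>
  have "emeasure ?M ?A = (\<integral>\<^sup>+ \<omega>. ennreal (log 10 (real (k + 1) / real k)) \<partial>P0)"
    unfolding U.emeasure_pair_measure_alt[OF A] using slice by (intro nn_integral_cong) auto
  also have "\<dots> = ennreal (log 10 (real (k + 1) / real k))"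
    by (simp add: P0.emeasure_space_1)
  finally show "measure ?M ?A = log 10 (real (k + 1) / real k)"
    using k by (simp add: measure_def)
qed

end
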